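(* Let $t>0$, let $i_1<\dots<i_M$ be real, let $\underline b=(b_2,\dots,b_{M-1})$ satisfy $-\frac{1}{i_{j+1}-i_j}<b_j<\frac{1}{i_j-i_{j-1}}$ for $j=2,\dots,M-1$, let $\underline k\in\mathbb R_+^{M-2}$ and $\underline\lambda=(\lambda_2,\dots,\lambda_{M-1})\in\mathbb R_+^{M-2}$. For every integer $p\ge1$, the matrix $\widetilde{\mathcal N}_t^{-p}$ has the representation $$(\widetilde{\mathcal N}_t^{-p})_{jk}=\mathbb P(Z_T=k\mid Z_0=j),\qquad j,k\in\{1,\dots,M+1\},$$ where $Z$ is a continuous time Markov chain on $\{1,\dots,M+1\}$ with intensity matrix $\Theta(\underline k,\underline\lambda)$ and $T$, independent of $Z$, has the $\mathrm{Gamma}(p,\frac1t)$ distribution (the law of the sum of $p$ independent exponential variables, each with intensity parameter $1/t$).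
   Context: Conventions: $\mathbb R_+=[0,\infty)$, $M\ge3$. Set $\widetilde k_j=(i_{j+1}-i_j)(i_j-i_{j-1})k_j$ for $2\le j\le M-1$, $\widetilde k_1=\widetilde k_M=0$; for $2\le j\le M-1$, $q_{j,j+1}=\frac{i_j-i_{j-1}}{i_{j+1}-i_{j-1}}(1+(i_{j+1}-i_j)b_j)$, $q_{j,j-1}=\frac{i_{j+1}-i_j}{i_{j+1}-i_{j-1}}(1-(i_j-i_{j-1})b_j)$. $\Theta=\Theta(\underline k,\underline\lambda)$ is the $(M+1)\times(M+1)$ matrix whose rows $1$, $M$, $M+1$ are zero and, for $2\le j\le M-1$, $\Theta_{j,j+1}=\lambda_jq_{j,j+1}$, $\Theta_{j,j-1}=\lambda_jq_{j,j-1}$ (neighbours in $\{1,\dots,M\}$), $\Theta_{jj}=-\lambda_j(1+\widetilde k_j)$, $\Theta_{j,M+1}=\lambda_j\widetilde k_j$, all other entries $0$. $\widetilde{\mathcal N}_t=\widetilde{\mathcal N}_t(\underline k,\underline\lambda)$ is the $(M+1)\times(M+1)$ matrix whose rows $1$, $M$, $M+1$ are those of the identity matrix and, for $2\le j\le M-1$, $\widetilde{\mathcal N}_{t;j,j}=1+t\lambda_j(1+\widetilde k_j)$, $\widetilde{\mathcal N}_{t;j,j+1}=-t\lambda_jq_{j,j+1}$, $\widetilde{\mathcal N}_{t;j,j-1}=-t\lambda_jq_{j,j-1}$, $\widetilde{\mathcal N}_{t;j,M+1}=-t\lambda_j\widetilde k_j$, all other entries $0$. *)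

theory Defs
  imports
    "HOL-Probability.Probability"
    "Jordan_Normal_Form.Gauss_Jordan_Elimination"
begin

section \<open>The matrices\<close>

text \<open>
  The points are \<open>i 1 < \<dots> < i M\<close>; the parameters \<open>b\<close>, \<open>k\<close>, \<open>l\<close> (for lambda) are only evaluated
  at the indices \<open>2, \<dots>, M - 1\<close>.  Matrix entries are given as functions of 1-based indices.
\<close>

definition k_tilde :: "nat \<Rightarrow> (nat \<Rightarrow> real) \<Rightarrow> (nat \<Rightarrow> real) \<Rightarrow> nat \<Rightarrow> real" where
  "k_tilde M i k j =
     (if 2 \<le> j \<and> j \<le> M - 1 then (i (j + 1) - i j) * (i j - i (j - 1)) * k j else 0)"

definition q_up :: "(nat \<Rightarrow> real) \<Rightarrow> (nat \<Rightarrow> real) \<Rightarrow> nat \<Rightarrow> real" where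
  "q_up i b j = (i j - i (j - 1)) / (i (j + 1) - i (j - 1)) * (1 + (i (j + 1) - i j) * b j)"

definition q_down :: "(nat \<Rightarrow> real) \<Rightarrow> (nat \<Rightarrow> real) \<Rightarrow> nat \<Rightarrow> real" where
  "q_down i b j = (i (j + 1) - i j) / (i (j + 1) - i (j - 1)) * (1 - (i j - i (j - 1)) * b j)"

definition Theta_entry ::
  "nat \<Rightarrow> (nat \<Rightarrow> real) \<Rightarrow> (nat \<Rightarrow> real) \<Rightarrow> (nat \<Rightarrow> real) \<Rightarrow> (nat \<Rightarrow> real) \<Rightarrow> nat \<Rightarrow> nat \<Rightarrow> real" where
  "Theta_entry M i b k l r c =
     (if 2 \<le> r \<and> r \<le> M - 1 then
        if c = r then - l r * (1 + k_tilde M i k r)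
        else if c = r + 1 then l r * q_up i b r
        else if c = r - 1 then l r * q_down i b r
        else if c = M + 1 then l r * k_tilde M i k r
        else 0
      else 0)"

definition N_entry ::
  "nat \<Rightarrow> (nat \<Rightarrow> real) \<Rightarrow> (nat \<Rightarrow> real) \<Rightarrow> (nat \<Rightarrow> real) \<Rightarrow> (nat \<Rightarrow> real) \<Rightarrow> real \<Rightarrow>
    nat \<Rightarrow> nat \<Rightarrow> real" where
  "N_entry M i b k l t r c =
     (if 2 \<le> r \<and> r \<le> M - 1 then
        if c = r then 1 + t * l r * (1 + k_tilde M i k r)
        else if c = r + 1 then - t * l r * q_up i b r
        else if c = r - 1 then - t * l r * q_down i b r
        else if c = M + 1 then - t * l r * k_tilde M i k r
        else 0
      else if c = r then 1 else 0)"

text \<open>Matrices of \<^typ>\<open>real mat\<close> are indexed from 0, hence the shift.\<close>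

definition N_mat ::
  "nat \<Rightarrow> (nat \<Rightarrow> real) \<Rightarrow> (nat \<Rightarrow> real) \<Rightarrow> (nat \<Rightarrow> real) \<Rightarrow> (nat \<Rightarrow> real) \<Rightarrow> real \<Rightarrow> real mat" where
  "N_mat M i b k l t = mat (M + 1) (M + 1) (\<lambda>(r, c). N_entry M i b k l t (r + 1) (c + 1))"


section \<open>Continuous time Markov chains on a finite state space\<close>

definition transition_function_of ::
  "'s set \<Rightarrow> ('s \<Rightarrow> 's \<Rightarrow> real) \<Rightarrow> (real \<Rightarrow> 's \<Rightarrow> 's \<Rightarrow> real) \<Rightarrow> bool" where
  "transition_function_of S Q P \<longleftrightarrow>
     (\<forall>s\<ge>0. \<forall>x\<in>S. \<forall>y\<in>S. 0 \<le> P s x y) \<and>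
     (\<forall>s\<ge>0. \<forall>x\<in>S. (\<Sum>y\<in>S. P s x y) = 1) \<and>
     (\<forall>x\<in>S. \<forall>y\<in>S. P 0 x y = (if x = y then 1 else 0)) \<and>
     (\<forall>s\<ge>0. \<forall>u\<ge>0. \<forall>x\<in>S. \<forall>y\<in>S. P (s + u) x y = (\<Sum>z\<in>S. P s x z * P u z y)) \<and>
     (\<forall>x\<in>S. \<forall>y\<in>S. ((\<lambda>s. P s x y) has_real_derivative Q x y) (at_right 0))"

text \<open>
  Time runs through \<open>[0, \<infinity>)\<close>; nothing is required of \<open>Z s\<close> for \<open>s < 0\<close>.  The state space carries
  the discrete topology, so right-continuity means being locally constant to the right.
\<close>

definition ctmc ::
  "'w measure \<Rightarrow> 's set \<Rightarrow> ('s \<Rightarrow> 's \<Rightarrow> real) \<Rightarrow> (real \<Rightarrow> 'w \<Rightarrow> 's) \<Rightarrow> bool" where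
  "ctmc \<Omega> S Q Z \<longleftrightarrow>
     prob_space \<Omega> \<and> finite S \<and>
     (\<forall>s\<ge>0. Z s \<in> \<Omega> \<rightarrow>\<^sub>M count_space S) \<and>
     (\<forall>\<omega>\<in>space \<Omega>. \<forall>s\<ge>0. \<forall>\<^sub>F u in at_right s. Z u \<omega> = Z s \<omega>) \<and>
     (\<exists>P. transition_function_of S Q P \<and>
        (\<forall>n (\<tau> :: nat \<Rightarrow> real) x.
           0 \<le> \<tau> 0 \<longrightarrow> strict_mono_on {..Suc n} \<tau> \<longrightarrow> (\<forall>m\<le>Suc n. x m \<in> S) \<longrightarrow>
           \<P>(\<omega> in \<Omega>. \<forall>m\<le>n. Z (\<tau> m) \<omega> = x m) > 0 \<longrightarrow>
           \<P>(\<omega> in \<Omega>. Z (\<tau> (Suc n)) \<omega> = x (Suc n) \<bar> \<forall>m\<le>n. Z (\<tau> m) \<omega> = x m)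
             = P (\<tau> (Suc n) - \<tau> n) (x n) (x (Suc n))))"

definition sigma_of_process ::
  "'w measure \<Rightarrow> 's set \<Rightarrow> (real \<Rightarrow> 'w \<Rightarrow> 's) \<Rightarrow> 'w set set" where
  "sigma_of_process \<Omega> S Z =
     sigma_sets (space \<Omega>) {Z s -` A \<inter> space \<Omega> | s A. 0 \<le> s \<and> A \<subseteq> S}"

definition indep_of_process ::
  "'w measure \<Rightarrow> 's set \<Rightarrow> ('w \<Rightarrow> real) \<Rightarrow> (real \<Rightarrow> 'w \<Rightarrow> 's) \<Rightarrow> bool" where
  "indep_of_process \<Omega> S T Z \<longleftrightarrow>
     prob_space.indep_set \<Omega> {T -` A \<inter> space \<Omega> | A. A \<in> sets borel} (sigma_of_process \<Omega> S Z)"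


section \<open>The Gamma distribution with integer shape\<close>

text \<open>The law of the sum of \<open>p\<close> independent exponential variables with intensity \<open>c\<close>.\<close>

definition gamma_law :: "nat \<Rightarrow> real \<Rightarrow> real measure" where
  "gamma_law p c =
     distr (\<Pi>\<^sub>M m\<in>{..<p}. density lborel (\<lambda>x. ennreal (exponential_density c x))) borel
       (\<lambda>x. \<Sum>m<p. x m)"

end

theory Submission
  imports Defs "HOL-Real_Asymp.Real_Asymp" "Jordan_Normal_Form.Determinant"
begin

text \<open>
  Let \<open>P\<close> be the transition function of \<open>Z\<close> and let \<open>R = E P(X)\<close> for an exponential \<open>X\<close> of
  intensity \<open>1 / t\<close>, the normalised resolvent.  Integrating the derivative of
  \<open>exp (- s / t) P s\<close> over \<open>[0, \<infinity>)\<close>, with the forward equation \<open>P' = P \<Theta>\<close>, gives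
  \<open>R (I - t \<Theta>) = I\<close>, and \<open>N = I - t \<Theta>\<close> is strictly diagonally dominant, so \<open>R\<close> is its
  inverse.  By Chapman--Kolmogorov and independence of the exponential summands, \<open>E P(T) = R\<^sup>p\<close>.
  Finally \<open>P(Z_T = m | Z_0 = j) = E P(T) j m\<close> is a countable sum when \<open>T\<close> lives on a grid, and
  follows in general by approximating \<open>T\<close> from above along the grids, as \<open>Z\<close> is right-continuous.
\<close>

abbreviation exponential_law :: "real \<Rightarrow> real measure" where
  "exponential_law c \<equiv> density lborel (\<lambda>x. ennreal (exponential_density c x))"

lemma AE_exponential_law_nonneg: "AE x in exponential_law c. 0 \<le> x"
  by (subst AE_density) (auto simp: exponential_density_def)

locale standard_transition_function =
  fixes S :: "'s set" and Q :: "'s \<Rightarrow> 's \<Rightarrow> real" and P :: "real \<Rightarrow> 's \<Rightarrow> 's \<Rightarrow> real"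
  assumes finite_S: "finite S" and transition: "transition_function_of S Q P"
begin

lemma
  shows nonneg: "\<lbrakk>0 \<le> s; x \<in> S; y \<in> S\<rbrakk> \<Longrightarrow> 0 \<le> P s x y"
    and row_sum: "\<lbrakk>0 \<le> s; x \<in> S\<rbrakk> \<Longrightarrow> (\<Sum>y\<in>S. P s x y) = 1"
    and P_0: "\<lbrakk>x \<in> S; y \<in> S\<rbrakk> \<Longrightarrow> P 0 x y = (if x = y then 1 else 0)"
    and Chapman_Kolmogorov:
      "\<lbrakk>0 \<le> s; 0 \<le> u; x \<in> S; y \<in> S\<rbrakk> \<Longrightarrow> P (s + u) x y = (\<Sum>z\<in>S. P s x z * P u z y)"
    and deriv_0: "\<lbrakk>x \<in> S; y \<in> S\<rbrakk> \<Longrightarrow> ((\<lambda>s. P s x y) has_real_derivative Q x y) (at_right 0)"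
  using transition unfolding transition_function_of_def by blast+

lemma le_1: "P s x y \<le> 1" if "0 \<le> s" "x \<in> S" "y \<in> S"
proof -
  have "P s x y \<le> (\<Sum>y\<in>S. P s x y)"
    by (rule member_le_sum) (use that nonneg finite_S in auto)
  thus ?thesis using row_sum that by simp
qed

lemma abs_le_1: "\<bar>P s x y\<bar> \<le> 1" if "0 \<le> s" "x \<in> S" "y \<in> S"
  using le_1[OF that] nonneg[OF that] by simp

lemma tendsto_diff_quotient_0:
  assumes "x \<in> S" "y \<in> S"
  shows "((\<lambda>h. (P h x y - P 0 x y) / h) \<longlongrightarrow> Q x y) (at_right 0)"
  using deriv_0[OF assms] by (simp add: has_field_derivative_iff)

lemma tendsto_diff_0:
  assumes "x \<in> S" "y \<in> S"
  shows "((\<lambda>h. P h x y - P 0 x y) \<longlongrightarrow> 0) (at_right 0)"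
proof -
  have "continuous (at_right 0) (\<lambda>s. P s x y)"
    using deriv_0[OF assms] by (rule DERIV_continuous)
  hence "((\<lambda>h. P h x y) \<longlongrightarrow> P 0 x y) (at_right 0)"
    by (simp add: continuous_within)
  thus ?thesis by (simp add: LIM_zero)
qed

lemma increment:
  assumes "0 \<le> s" "0 \<le> h" "x \<in> S" "y \<in> S"
  shows "P (s + h) x y - P s x y = (\<Sum>z\<in>S. P s x z * (P h z y - P 0 z y))"
proof -
  have "P s x y = (\<Sum>z\<in>S. P s x z * P 0 z y)"
    using Chapman_Kolmogorov[of s 0 x y] assms by simp
  thus ?thesis using Chapman_Kolmogorov[OF assms]
    by (simp add: right_diff_distrib sum_subtractf)
qed

lemma tendsto_left:
  assumes "0 < s" "x \<in> S" "y \<in> S"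
  shows "((\<lambda>h. P (s - h) x y) \<longlongrightarrow> P s x y) (at_right 0)"
proof -
  have "((\<lambda>h. P s x y - P (s - h) x y) \<longlongrightarrow> 0) (at_right 0)"
  proof (rule Lim_null_comparison)
    show "((\<lambda>h. \<Sum>z\<in>S. \<bar>P h z y - P 0 z y\<bar>) \<longlongrightarrow> 0) (at_right 0)"
      by (intro tendsto_null_sum tendsto_rabs_zero tendsto_diff_0 assms)
    have "eventually (\<lambda>h. h \<in> {0<..<s}) (at_right 0)"
      using eventually_at_right_real[OF \<open>0 < s\<close>] .
    thus "\<forall>\<^sub>F h in at_right 0. norm (P s x y - P (s - h) x y)
        \<le> (\<Sum>z\<in>S. \<bar>P h z y - P 0 z y\<bar>)"
    proof eventually_elim
      case (elim h)
      have "P s x y - P (s - h) x y = (\<Sum>z\<in>S. P (s - h) x z * (P h z y - P 0 z y))"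
        using increment[of "s - h" h x y] elim assms by simp
      also have "\<bar>\<dots>\<bar> \<le> (\<Sum>z\<in>S. \<bar>P (s - h) x z * (P h z y - P 0 z y)\<bar>)"
        by (rule sum_abs)
      also have "\<dots> \<le> (\<Sum>z\<in>S. \<bar>P h z y - P 0 z y\<bar>)"
      proof (rule sum_mono)
        fix z assume "z \<in> S"
        hence "\<bar>P (s - h) x z\<bar> \<le> 1" using abs_le_1[of "s - h" x z] elim assms by simp
        thus "\<bar>P (s - h) x z * (P h z y - P 0 z y)\<bar> \<le> \<bar>P h z y - P 0 z y\<bar>"
          by (simp add: abs_mult mult_left_le_one_le)
      qed
      finally show ?case by simp
    qed
  qed
  from tendsto_diff[OF tendsto_const[of "P s x y"] this] show ?thesis by simp
qed

lemma forward_equation_right: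
  assumes "0 \<le> s" "x \<in> S" "y \<in> S"
  shows "((\<lambda>s. P s x y) has_real_derivative (\<Sum>z\<in>S. P s x z * Q z y)) (at_right s)"
proof -
  have "((\<lambda>h. \<Sum>z\<in>S. P s x z * ((P h z y - P 0 z y) / h)) \<longlongrightarrow> (\<Sum>z\<in>S. P s x z * Q z y)) (at_right 0)"
    by (intro tendsto_intros tendsto_diff_quotient_0 assms)
  moreover have "\<forall>\<^sub>F h in at_right 0. (\<Sum>z\<in>S. P s x z * ((P h z y - P 0 z y) / h))
      = (P (h + s) x y - P s x y) / (h + s - s)"
    using eventually_at_right_less[of 0]
  proof eventually_elim
    case (elim h)
    thus ?case using increment[of s h x y] assms
      by (simp add: sum_divide_distrib add.commute)
  qed
  ultimately show ?thesis
    unfolding has_field_derivative_iff filterlim_at_right_to_0[of _ _ s]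
    by (rule Lim_transform_eventually)
qed

lemma forward_equation:
  assumes "0 < s" "x \<in> S" "y \<in> S"
  shows "((\<lambda>s. P s x y) has_real_derivative (\<Sum>z\<in>S. P s x z * Q z y)) (at s)"
proof -
  have "((\<lambda>h. \<Sum>z\<in>S. P (s - h) x z * ((P h z y - P 0 z y) / h))
      \<longlongrightarrow> (\<Sum>z\<in>S. P s x z * Q z y)) (at_right 0)"
    by (intro tendsto_intros tendsto_diff_quotient_0 tendsto_left assms)
  moreover have "\<forall>\<^sub>F h in at_right 0. (\<Sum>z\<in>S. P (s - h) x z * ((P h z y - P 0 z y) / h))
      = (P (- (h + - s)) x y - P s x y) / (- (h + - s) - s)"
    using eventually_at_right_real[OF \<open>0 < s\<close>]
  proof eventually_elim
    case (elim h)
    hence "P s x y - P (s - h) x y = (\<Sum>z\<in>S. P (s - h) x z * (P h z y - P 0 z y))"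
      using increment[of "s - h" h x y] assms by simp
    hence "(\<Sum>z\<in>S. P (s - h) x z * ((P h z y - P 0 z y) / h)) = (P s x y - P (s - h) x y) / h"
      by (simp add: sum_divide_distrib)
    also have "\<dots> = (P (s - h) x y - P s x y) / (- h)"
      by (simp add: minus_divide_right [symmetric] diff_divide_distrib)
    finally show ?case by simp
  qed
  ultimately have "((\<lambda>y'. (P y' x y - P s x y) / (y' - s)) \<longlongrightarrow> (\<Sum>z\<in>S. P s x z * Q z y)) (at_left s)"
    unfolding filterlim_at_left_to_right filterlim_at_right_to_0[of _ _ "- s"]
    by (rule Lim_transform_eventually)
  moreover have "((\<lambda>y'. (P y' x y - P s x y) / (y' - s)) \<longlongrightarrow> (\<Sum>z\<in>S. P s x z * Q z y)) (at_right s)"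
    using forward_equation_right[of s x y] assms by (simp add: has_field_derivative_iff)
  ultimately show ?thesis
    unfolding has_field_derivative_iff by (rule filterlim_split_at)
qed

lemma isCont_P: "isCont (\<lambda>s. P s x y) s" if "0 < s" "x \<in> S" "y \<in> S"
  using forward_equation[OF that] by (rule DERIV_isCont)

lemma tendsto_right:
  "((\<lambda>s. P s x y) \<longlongrightarrow> P s x y) (at_right s)" if "0 \<le> s" "x \<in> S" "y \<in> S"
  using DERIV_continuous[OF forward_equation_right[OF that]] by (simp add: continuous_within)

lemma borel_measurable_P [measurable]:
  assumes "x \<in> S" "y \<in> S"
  shows "(\<lambda>s. P (max 0 s) x y) \<in> borel_measurable borel"
proof -
  have "continuous_on UNIV (\<lambda>s. P (max 0 s) x y)"
    unfolding continuous_on_eq_continuous_within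
  proof safe
    fix s :: real
    show "isCont (\<lambda>s. P (max 0 s) x y) s"
    proof (cases "0 < s")
      case True
      hence "isCont (\<lambda>s. P s x y) (max 0 s)" using isCont_P assms by simp
      thus ?thesis by (rule isCont_o2[rotated]) (intro continuous_intros)
    next
      case False
      have "((\<lambda>h. P h x y) \<longlongrightarrow> P 0 x y) (at_right 0)"
        using tendsto_right[of 0 x y] assms by simp
      hence "continuous (at 0 within {0..}) (\<lambda>h. P h x y)"
        by (simp add: continuous_within at_within_Ici_at_right)
      moreover have "max 0 s = 0" using False by simp
      ultimately have "continuous (at (max 0 s) within range (\<lambda>s. max 0 s)) (\<lambda>h. P h x y)"
        by (auto intro: continuous_within_subset)
      moreover have "isCont (\<lambda>s. max 0 s) s" by (intro continuous_intros)
      ultimately show ?thesis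
        using continuous_within_compose2[of s UNIV "\<lambda>s. max 0 s" "\<lambda>h. P h x y"] by simp
    qed
  qed
  thus ?thesis by (rule borel_measurable_continuous_onI)
qed

lemma integrable_P:
  assumes "finite_measure N" "g \<in> borel_measurable N" "x \<in> S" "y \<in> S"
  shows "integrable N (\<lambda>\<omega>. P (max 0 (g \<omega>)) x y)"
proof -
  interpret finite_measure N by fact
  have "(\<lambda>\<omega>. P (max 0 (g \<omega>)) x y) \<in> borel_measurable N"
    using measurable_compose[OF assms(2) borel_measurable_P[OF assms(3,4)]] by simp
  thus ?thesis
    by (intro integrable_const_bound[where B = 1]) (use abs_le_1 assms in auto)
qed


text \<open>Normalised: this is \<open>c\<close> times the usual resolvent.  The argument \<open>max 0 s\<close> is used because
  nothing, not even measurability, is known of \<open>P s\<close> for \<open>s < 0\<close>.\<close>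

definition resolvent :: "real \<Rightarrow> 's \<Rightarrow> 's \<Rightarrow> real" where
  "resolvent c x y = (LINT s|exponential_law c. P (max 0 s) x y)"

lemma resolvent_equation:
  assumes c: "0 < c" and x: "x \<in> S" and y: "y \<in> S"
  shows "resolvent c x y - (\<Sum>z\<in>S. resolvent c x z * Q z y) / c = (if x = y then 1 else 0)"
proof -
  interpret E: prob_space "exponential_law c"
    by (rule prob_space_exponential_density[OF c])
  define g where "g s = (\<Sum>z\<in>S. P (max 0 s) x z * Q z y) - c * P (max 0 s) x y" for s
  define f where "f s = c * exp (- s * c) * ((\<Sum>z\<in>S. P s x z * Q z y) - c * P s x y)" for s
  define F where "F s = c * exp (- s * c) * P s x y" for s
  have int_P: "integrable (exponential_law c) (\<lambda>s. P (max 0 s) x z)" if "z \<in> S" for z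
    using integrable_P[OF E.finite_measure_axioms _ x that, of "\<lambda>s. s"] by simp
  have int_g: "integrable (exponential_law c) g"
    unfolding g_def using int_P y by (intro Bochner_Integration.integrable_diff
      Bochner_Integration.integrable_sum integrable_mult_left integrable_mult_right) auto
  have g_meas [measurable]: "g \<in> borel_measurable borel"
    using borel_measurable_integrable[OF int_g] by simp
  have "(LINT s|exponential_law c. g s)
      = (\<Sum>z\<in>S. resolvent c x z * Q z y) - c * resolvent c x y"
    unfolding g_def resolvent_def using int_P y by simp
  moreover have "(LINT s|exponential_law c. g s) = (LINT s|lborel. exponential_density c s * g s)"
    by (subst integral_density) (use c in \<open>auto simp: exponential_density_nonneg\<close>)
  moreover have eq: "AE s in lborel. exponential_density c s * g s = indicator {0<..} s *\<^sub>R f s"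
    using AE_lborel_singleton[of 0]
    by eventually_elim (auto simp: exponential_density_def f_def g_def indicator_def)
  have int_f: "integrable lborel (\<lambda>s. indicator {0<..} s *\<^sub>R f s)"
  proof -
    have "integrable lborel (\<lambda>s. exponential_density c s * g s)"
      using int_g by (subst (asm) integrable_density) (use c in \<open>auto simp: exponential_density_nonneg\<close>)
    moreover have "indicator {0<..} s *\<^sub>R f s
        = indicator {0<..} s *\<^sub>R (exponential_density c s * g s)" for s
      by (auto simp: exponential_density_def f_def g_def indicator_def)
    ultimately show ?thesis
      by (simp only: integrable_mult_indicator borel_open sets_lborel open_greaterThan)
  qed
  have "(LINT s|lborel. exponential_density c s * g s) = (LINT s|lborel. indicator {0<..} s *\<^sub>R f s)"
    by (rule integral_cong_AE[OF _ borel_measurable_integrable[OF int_f] eq]) measurable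
  moreover have "\<dots> = (LBINT s=ereal 0..\<infinity>. f s)"
    by (simp add: interval_lebesgue_integral_def set_lebesgue_integral_def)
  moreover have "\<dots> = 0 - F 0"
  proof (rule interval_integral_FTC_integrable)
    fix s :: real assume "ereal 0 < ereal s"
    hence s: "0 < s" by simp
    show "(F has_vector_derivative f s) (at s)"
      unfolding has_real_derivative_iff_has_vector_derivative[symmetric] F_def
      by (rule derivative_eq_intros forward_equation[OF s x y] refl | simp add: f_def algebra_simps)+
    show "isCont f s"
      unfolding f_def by (intro continuous_intros isCont_P s x y)
  next
    show "set_integrable lborel (einterval (ereal 0) \<infinity>) f"
      using int_f by (simp add: set_integrable_def)
    have "(F \<longlongrightarrow> F 0) (at_right 0)"
      unfolding F_def by (intro tendsto_intros tendsto_right x y order_refl)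
    thus "((F \<circ> real_of_ereal) \<longlongrightarrow> F 0) (at_right (ereal 0))"
      by (simp add: ereal_tendsto_simps)
    have "(F \<longlongrightarrow> 0) at_top"
    proof (rule Lim_null_comparison)
      show "\<forall>\<^sub>F s in at_top. norm (F s) \<le> c * exp (- s * c)"
        using eventually_ge_at_top[of 0]
        by eventually_elim
          (use c abs_le_1[OF _ x y] in \<open>simp add: F_def abs_mult mult_le_one mult_left_le\<close>)
      have "((\<lambda>s. exp (- s * c)) \<longlongrightarrow> 0) at_top"
        using c by real_asymp
      from tendsto_mult_right_zero[OF this, of c]
      show "((\<lambda>s. c * exp (- s * c)) \<longlongrightarrow> 0) at_top" .
    qed
    thus "((F \<circ> real_of_ereal) \<longlongrightarrow> 0) (at_left \<infinity>)"
      by (simp add: ereal_tendsto_simps)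
  qed simp
  ultimately have "c * resolvent c x y - (\<Sum>z\<in>S. resolvent c x z * Q z y)
      = c * (if x = y then 1 else 0)"
    using P_0[OF x y] by (simp add: F_def)
  thus ?thesis using c by (simp add: field_simps split: if_splits)
qed

definition gamma_mean :: "real \<Rightarrow> nat \<Rightarrow> 's \<Rightarrow> 's \<Rightarrow> real" where
  "gamma_mean c p x y = (LINT s|gamma_law p c. P (max 0 s) x y)"

lemma gamma_mean_eq:
  assumes "x \<in> S" "y \<in> S"
  shows "gamma_mean c p x y
    = (LINT u|(\<Pi>\<^sub>M m\<in>{..<p}. exponential_law c). P (max 0 (\<Sum>m<p. u m)) x y)"
  unfolding gamma_mean_def gamma_law_def
  by (rule integral_distr) (use assms in measurable)

lemma gamma_mean_0:
  assumes "x \<in> S" "y \<in> S"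
  shows "gamma_mean c 0 x y = (if x = y then 1 else 0)"
  by (simp add: gamma_mean_eq[OF assms] P_0[OF assms] PiM_empty lebesgue_integral_count_space_finite)

lemma gamma_mean_Suc:
  assumes c: "0 < c" and x: "x \<in> S" and y: "y \<in> S"
  shows "gamma_mean c (Suc p) x y = (\<Sum>z\<in>S. gamma_mean c p x z * resolvent c z y)"
proof -
  let ?E = "exponential_law c"
  interpret E: prob_space ?E
    by (rule prob_space_exponential_density[OF c])
  interpret product_prob_space "\<lambda>_::nat. ?E"
    by standard
  let ?\<Pi> = "\<Pi>\<^sub>M m\<in>{..<p}. ?E"
  interpret \<Pi>: prob_space ?\<Pi>
    by (rule prob_space_PiM) (rule E.prob_space_axioms)
  have int_E: "integrable ?E (\<lambda>s. P (max 0 s) z y)" if "z \<in> S" for z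
    using integrable_P[OF E.finite_measure_axioms _ that y, of "\<lambda>s. s"] by simp
  have int_\<Pi>: "integrable ?\<Pi> (\<lambda>u. P (max 0 (\<Sum>m<p. u m)) x z)" if "z \<in> S" for z
    by (rule integrable_P[OF \<Pi>.finite_measure_axioms _ x that]) measurable
  have ins: "insert p {..<p} = {..<Suc p}" by auto
  have "finite_measure (\<Pi>\<^sub>M m\<in>{..<Suc p}. ?E)"
    by (rule prob_space.finite_measure, rule prob_space_PiM) (rule E.prob_space_axioms)
  hence int_Suc: "integrable (\<Pi>\<^sub>M m\<in>{..<Suc p}. ?E) (\<lambda>u. P (max 0 (\<Sum>m<Suc p. u m)) x y)"
    by (rule integrable_P[OF _ _ x y]) measurable
  have "AE u in ?\<Pi>. \<forall>m\<in>{..<p}. 0 \<le> u m"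
    by (intro eventually_ball_finite ballI AE_PiM_component E.prob_space_axioms
        AE_exponential_law_nonneg) auto
  hence inner: "AE u in ?\<Pi>. (LINT s|?E. P (max 0 (\<Sum>m<Suc p. (u(p := s)) m)) x y)
      = (\<Sum>z\<in>S. P (max 0 (\<Sum>m<p. u m)) x z * resolvent c z y)"
  proof eventually_elim
    case (elim u)
    hence u: "0 \<le> (\<Sum>m<p. u m)" by (intro sum_nonneg) auto
    have "(LINT s|?E. P (max 0 (\<Sum>m<Suc p. (u(p := s)) m)) x y)
        = (LINT s|?E. (\<Sum>z\<in>S. P (max 0 (\<Sum>m<p. u m)) x z * P (max 0 s) z y))"
    proof (rule integral_cong_AE)
      show "AE s in ?E. P (max 0 (\<Sum>m<Suc p. (u(p := s)) m)) x y
          = (\<Sum>z\<in>S. P (max 0 (\<Sum>m<p. u m)) x z * P (max 0 s) z y)"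
        using AE_exponential_law_nonneg
      proof eventually_elim
        case (elim s)
        thus ?case using u Chapman_Kolmogorov[OF u elim x y] by simp
      qed
      show "(\<lambda>s. P (max 0 (\<Sum>m<Suc p. (u(p := s)) m)) x y) \<in> borel_measurable ?E"
        using borel_measurable_integrable[OF integrable_P[OF E.finite_measure_axioms _ x y,
          of "\<lambda>s. (\<Sum>m<p. u m) + s"]] by simp
    qed (use int_E in \<open>auto intro!: borel_measurable_sum borel_measurable_times
          dest: borel_measurable_integrable\<close>)
    also have "\<dots> = (\<Sum>z\<in>S. P (max 0 (\<Sum>m<p. u m)) x z * resolvent c z y)"
      unfolding resolvent_def using int_E by simp
    finally show ?case .
  qed
  have "gamma_mean c (Suc p) x y
      = (LINT u|?\<Pi>. (LINT s|?E. P (max 0 (\<Sum>m<Suc p. (u(p := s)) m)) x y))"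
    unfolding gamma_mean_eq[OF x y] ins[symmetric]
    by (rule product_integral_insert) (use int_Suc in \<open>simp_all only: ins, auto\<close>)
  also have "\<dots> = (LINT u|?\<Pi>. (\<Sum>z\<in>S. P (max 0 (\<Sum>m<p. u m)) x z * resolvent c z y))"
  proof (rule integral_cong_AE[OF _ _ inner])
    have "(\<lambda>(u, s). P (max 0 (\<Sum>m<Suc p. (u(p := s)) m)) x y) \<in> borel_measurable (?\<Pi> \<Otimes>\<^sub>M ?E)"
    proof -
      have "(\<lambda>us. (\<Sum>m<p. fst us m) + snd us) \<in> borel_measurable (?\<Pi> \<Otimes>\<^sub>M ?E)"
        by measurable
      from measurable_compose[OF this borel_measurable_P[OF x y]]
      show ?thesis by (simp add: case_prod_beta)
    qed
    thus "(\<lambda>u. LINT s|?E. P (max 0 (\<Sum>m<Suc p. (u(p := s)) m)) x y) \<in> borel_measurable ?\<Pi>"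
      by (rule E.borel_measurable_lebesgue_integral)
    show "(\<lambda>u. \<Sum>z\<in>S. P (max 0 (\<Sum>m<p. u m)) x z * resolvent c z y) \<in> borel_measurable ?\<Pi>"
      using int_\<Pi> by (auto intro!: borel_measurable_sum borel_measurable_times
          dest: borel_measurable_integrable)
  qed
  also have "\<dots> = (\<Sum>z\<in>S. gamma_mean c p x z * resolvent c z y)"
    using int_\<Pi> by (simp add: gamma_mean_eq[OF x])
  finally show ?thesis .
qed

end

lemma (in prob_space) prob_random_index:
  fixes K :: "'a \<Rightarrow> nat"
  assumes K: "K \<in> M \<rightarrow>\<^sub>M count_space UNIV" and A: "\<And>k. A k \<in> events"
    and indep: "\<And>k. prob ({\<omega> \<in> space M. K \<omega> = k} \<inter> A k) = prob {\<omega> \<in> space M. K \<omega> = k} * prob (A k)"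
  shows "prob {\<omega> \<in> space M. \<omega> \<in> A (K \<omega>)} = (LINT \<omega>|M. prob (A (K \<omega>)))"
proof -
  let ?B = "\<lambda>k. {\<omega> \<in> space M. K \<omega> = k}"
  have B: "?B k \<in> events" for k
    using K by measurable
  have "(\<integral>\<^sup>+\<omega>. ennreal (prob (A (K \<omega>))) \<partial>M)
      = (\<integral>\<^sup>+\<omega>. (\<Sum>k. ennreal (prob (A k)) * indicator (?B k) \<omega>) \<partial>M)"
  proof (rule nn_integral_cong)
    fix \<omega> assume "\<omega> \<in> space M"
    thus "ennreal (prob (A (K \<omega>))) = (\<Sum>k. ennreal (prob (A k)) * indicator (?B k) \<omega>)"
      by (subst suminf_finite[of "{K \<omega>}"]) (auto simp: indicator_def)
  qed
  also have "\<dots> = (\<Sum>k. ennreal (prob (A k)) * emeasure M (?B k))"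
    using B by (simp add: nn_integral_suminf nn_integral_cmult_indicator)
  also have "\<dots> = (\<Sum>k. emeasure M (?B k \<inter> A k))"
    by (simp add: emeasure_eq_measure indep ennreal_mult'' mult.commute)
  also have "\<dots> = emeasure M (\<Union>k. ?B k \<inter> A k)"
    by (rule suminf_emeasure) (use A B in \<open>auto simp: disjoint_family_on_def\<close>)
  also have "(\<Union>k. ?B k \<inter> A k) = {\<omega> \<in> space M. \<omega> \<in> A (K \<omega>)}"
    by auto
  finally have "(\<integral>\<^sup>+\<omega>. ennreal (prob (A (K \<omega>))) \<partial>M) = ennreal (prob {\<omega> \<in> space M. \<omega> \<in> A (K \<omega>)})"
    by (simp add: emeasure_eq_measure)
  moreover have "(\<lambda>\<omega>. prob (A (K \<omega>))) \<in> borel_measurable M"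
    using measurable_compose[OF K, of "\<lambda>k. prob (A k)"] by simp
  ultimately show ?thesis
    by (subst integral_eq_nn_integral) auto
qed


lemma (in standard_transition_function) cond_prob_random_time:
  assumes "prob_space \<Omega>"
    and Z: "\<And>s. 0 \<le> s \<Longrightarrow> Z s \<in> \<Omega> \<rightarrow>\<^sub>M count_space S"
    and right_cont: "\<And>\<omega> s. \<lbrakk>\<omega> \<in> space \<Omega>; 0 \<le> s\<rbrakk> \<Longrightarrow> \<forall>\<^sub>F u in at_right s. Z u \<omega> = Z s \<omega>"
    and j: "j \<in> S" and m: "m \<in> S" and pos: "\<P>(\<omega> in \<Omega>. Z 0 \<omega> = j) > 0"
    and cond: "\<And>s. 0 < s \<Longrightarrow> \<P>(\<omega> in \<Omega>. Z s \<omega> = m \<bar> Z 0 \<omega> = j) = P s j m"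
    and T: "T \<in> borel_measurable \<Omega>" and T_nonneg: "\<And>\<omega>. \<omega> \<in> space \<Omega> \<Longrightarrow> 0 \<le> T \<omega>"
    and indep: "indep_of_process \<Omega> S T Z"
  shows "\<P>(\<omega> in \<Omega>. Z (T \<omega>) \<omega> = m \<bar> Z 0 \<omega> = j) = (LINT \<omega>|\<Omega>. P (max 0 (T \<omega>)) j m)"
proof -
  interpret prob_space \<Omega> by fact
  note T [measurable]
  define K where "K n \<omega> = nat \<lfloor>real (Suc n) * T \<omega>\<rfloor>" for n \<omega>
  define \<tau> where "\<tau> n \<omega> = real (Suc (K n \<omega>)) / real (Suc n)" for n \<omega>
  define A where "A n k = {\<omega> \<in> space \<Omega>. Z (real (Suc k) / real (Suc n)) \<omega> = m \<and> Z 0 \<omega> = j}" for n k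
  let ?p = "\<P>(\<omega> in \<Omega>. Z 0 \<omega> = j)"
  let ?f = "\<lambda>n \<omega>. indicator (A n (K n \<omega>)) \<omega> :: real"
  let ?g = "\<lambda>\<omega>. indicator {\<omega> \<in> space \<Omega>. Z (T \<omega>) \<omega> = m \<and> Z 0 \<omega> = j} \<omega> :: real"

  have K_meas [measurable]: "K n \<in> \<Omega> \<rightarrow>\<^sub>M count_space UNIV" for n
    unfolding K_def by measurable
  have vimage: "{\<omega> \<in> space \<Omega>. Z s \<omega> = x} = Z s -` {x} \<inter> space \<Omega>" for s x by auto
  have Z_eq: "{\<omega> \<in> space \<Omega>. Z s \<omega> = x} \<in> sigma_of_process \<Omega> S Z" if "0 \<le> s" "x \<in> S" for s x
    unfolding vimage sigma_of_process_def by (rule sigma_sets.Basic) (use that in blast)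
  have A_eq: "A n k = {\<omega> \<in> space \<Omega>. Z (real (Suc k) / real (Suc n)) \<omega> = m} \<inter> {\<omega> \<in> space \<Omega>. Z 0 \<omega> = j}"
    for n k unfolding A_def by auto
  have A_process: "A n k \<in> sigma_of_process \<Omega> S Z" for n k
  proof -
    interpret sigma_algebra "space \<Omega>" "sigma_of_process \<Omega> S Z"
      unfolding sigma_of_process_def by (rule sigma_algebra_sigma_sets) auto
    show ?thesis unfolding A_eq by (intro Int Z_eq j m) auto
  qed
  have Z_sets: "{\<omega> \<in> space \<Omega>. Z s \<omega> = x} \<in> events" if "0 \<le> s" "x \<in> S" for s x
    unfolding vimage by (rule measurable_sets[OF Z]) (use that in auto)
  have A_sets: "A n k \<in> events" for n k
    unfolding A_eq by (intro sets.Int Z_sets j m) auto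
  have prob_A: "prob (A n k) = ?p * P (real (Suc k) / real (Suc n)) j m" for n k
    using cond[of "real (Suc k) / real (Suc n)"] pos by (simp add: cond_prob_def A_def field_simps)

  have prob_f: "(LINT \<omega>|\<Omega>. ?f n \<omega>) = ?p * (LINT \<omega>|\<Omega>. P (max 0 (\<tau> n \<omega>)) j m)" for n
  proof -
    have "prob ({\<omega> \<in> space \<Omega>. K n \<omega> = k} \<inter> A n k) = prob {\<omega> \<in> space \<Omega>. K n \<omega> = k} * prob (A n k)" for k
    proof (rule indep_setD[OF indep[unfolded indep_of_process_def] _ A_process])
      have "{\<omega> \<in> space \<Omega>. K n \<omega> = k} = T -` {x. nat \<lfloor>real (Suc n) * x\<rfloor> = k} \<inter> space \<Omega>"
        by (auto simp: K_def)
      moreover have "{x. nat \<lfloor>real (Suc n) * x\<rfloor> = k} \<in> sets borel"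
        by measurable
      ultimately show "{\<omega> \<in> space \<Omega>. K n \<omega> = k} \<in> {T -` A \<inter> space \<Omega> |A. A \<in> sets borel}"
        by blast
    qed
    from prob_random_index[OF K_meas A_sets this]
    have "prob {\<omega> \<in> space \<Omega>. \<omega> \<in> A n (K n \<omega>)} = ?p * (LINT \<omega>|\<Omega>. P (max 0 (\<tau> n \<omega>)) j m)"
      by (simp add: prob_A \<tau>_def)
    moreover have "(LINT \<omega>|\<Omega>. ?f n \<omega>) = (LINT \<omega>|\<Omega>. indicator {\<omega> \<in> space \<Omega>. \<omega> \<in> A n (K n \<omega>)} \<omega>)"
      by (rule Bochner_Integration.integral_cong) (auto simp: indicator_def)
    ultimately show ?thesis
      by (simp add: Int_absorb2)
  qed

  have \<tau>_lim: "filterlim (\<lambda>n. \<tau> n \<omega>) (at_right (T \<omega>)) sequentially" if "\<omega> \<in> space \<Omega>" for \<omega>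
  proof -
    have bounds: "T \<omega> < \<tau> n \<omega>" "\<tau> n \<omega> \<le> T \<omega> + 1 / real (Suc n)" for n
    proof -
      have "0 \<le> real (Suc n) * T \<omega>" using T_nonneg[OF that] by simp
      hence "real (K n \<omega>) = of_int \<lfloor>real (Suc n) * T \<omega>\<rfloor>" by (simp add: K_def)
      hence "real (K n \<omega>) \<le> real (Suc n) * T \<omega>" "real (Suc n) * T \<omega> < real (K n \<omega>) + 1"
        by linarith+
      note K = this
      show "T \<omega> < \<tau> n \<omega>" using K(2) by (simp add: \<tau>_def field_simps)
      have "\<tau> n \<omega> \<le> (real (Suc n) * T \<omega> + 1) / real (Suc n)"
        unfolding \<tau>_def by (rule divide_right_mono) (use K(1) in auto)
      thus "\<tau> n \<omega> \<le> T \<omega> + 1 / real (Suc n)" by (simp add: add_divide_distrib)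
    qed
    have "(\<lambda>n. \<tau> n \<omega>) \<longlonglongrightarrow> T \<omega>"
    proof (rule tendsto_sandwich[where f = "\<lambda>_. T \<omega>" and h = "\<lambda>n. T \<omega> + 1 / real (Suc n)"])
      show "(\<lambda>n. T \<omega> + 1 / real (Suc n)) \<longlonglongrightarrow> T \<omega>"
        using LIMSEQ_inverse_real_of_nat_add[of "T \<omega>"] by (simp add: inverse_eq_divide)
    qed (intro always_eventually allI less_imp_le bounds tendsto_const)+
    moreover have "\<tau> n \<omega> \<in> {T \<omega><..} \<and> \<tau> n \<omega> \<noteq> T \<omega>" for n
      using bounds(1)[of n] by simp
    ultimately show ?thesis by (simp add: filterlim_at)
  qed

  have f_lim: "(\<lambda>n. ?f n \<omega>) \<longlonglongrightarrow> ?g \<omega>" if \<omega>: "\<omega> \<in> space \<Omega>" for \<omega>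
  proof (rule tendsto_eventually)
    have "\<forall>\<^sub>F n in sequentially. Z (\<tau> n \<omega>) \<omega> = Z (T \<omega>) \<omega>"
      using right_cont[OF \<omega> T_nonneg[OF \<omega>]] \<tau>_lim[OF \<omega>] by (rule eventually_compose_filterlim)
    thus "\<forall>\<^sub>F n in sequentially. ?f n \<omega> = ?g \<omega>"
      by eventually_elim (auto simp: A_def \<tau>_def indicator_def)
  qed
  have f_meas: "?f n \<in> borel_measurable \<Omega>" for n
  proof -
    have "(\<lambda>\<omega>. (\<lambda>k \<omega>. indicator (A n k) \<omega> :: real) (K n \<omega>) \<omega>) \<in> borel_measurable \<Omega>"
      by (rule measurable_compose_countable[OF _ K_meas]) (use A_sets in measurable)
    thus ?thesis by simp
  qed
  have "(\<lambda>n. LINT \<omega>|\<Omega>. ?f n \<omega>) \<longlonglongrightarrow> (LINT \<omega>|\<Omega>. ?g \<omega>)"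
  proof (rule integral_dominated_convergence[where w = "\<lambda>_. 1"])
    show "?g \<in> borel_measurable \<Omega>"
      by (rule borel_measurable_LIMSEQ_real[OF f_lim f_meas])
  qed (use f_lim f_meas in \<open>auto simp: indicator_def\<close>)
  moreover have "(\<lambda>n. LINT \<omega>|\<Omega>. P (max 0 (\<tau> n \<omega>)) j m) \<longlonglongrightarrow> (LINT \<omega>|\<Omega>. P (max 0 (T \<omega>)) j m)"
  proof (rule integral_dominated_convergence[where w = "\<lambda>_. 1"])
    show "(\<lambda>\<omega>. P (max 0 (T \<omega>)) j m) \<in> borel_measurable \<Omega>"
      using integrable_P[OF finite_measure_axioms T j m] by (rule borel_measurable_integrable)
    show "(\<lambda>\<omega>. P (max 0 (\<tau> n \<omega>)) j m) \<in> borel_measurable \<Omega>" for n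
      by (rule borel_measurable_integrable[OF integrable_P[OF finite_measure_axioms _ j m]])
        (simp add: \<tau>_def)
    show "AE \<omega> in \<Omega>. (\<lambda>n. P (max 0 (\<tau> n \<omega>)) j m) \<longlonglongrightarrow> P (max 0 (T \<omega>)) j m"
    proof (rule AE_I2)
      fix \<omega> assume \<omega>: "\<omega> \<in> space \<Omega>"
      have "0 \<le> \<tau> n \<omega>" for n by (simp add: \<tau>_def)
      moreover have "(\<lambda>n. P (\<tau> n \<omega>) j m) \<longlonglongrightarrow> P (T \<omega>) j m"
        by (rule filterlim_compose[OF tendsto_right[OF T_nonneg[OF \<omega>] j m] \<tau>_lim[OF \<omega>]])
      ultimately show "(\<lambda>n. P (max 0 (\<tau> n \<omega>)) j m) \<longlonglongrightarrow> P (max 0 (T \<omega>)) j m"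
        using T_nonneg[OF \<omega>] by simp
    qed
  qed (use abs_le_1 j m in auto)
  hence "(\<lambda>n. LINT \<omega>|\<Omega>. ?f n \<omega>) \<longlonglongrightarrow> ?p * (LINT \<omega>|\<Omega>. P (max 0 (T \<omega>)) j m)"
    unfolding prob_f by (rule tendsto_mult_left)
  ultimately have "(LINT \<omega>|\<Omega>. ?g \<omega>) = ?p * (LINT \<omega>|\<Omega>. P (max 0 (T \<omega>)) j m)"
    by (rule LIMSEQ_unique)
  moreover have "(LINT \<omega>|\<Omega>. ?g \<omega>) = \<P>(\<omega> in \<Omega>. Z (T \<omega>) \<omega> = m \<and> Z 0 \<omega> = j)"
    by (simp add: Int_absorb2)
  ultimately show ?thesis
    using pos by (simp add: cond_prob_def field_simps)
qed

lemma det_nonzero_diagonally_dominant: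
  fixes A :: "real mat"
  assumes A: "A \<in> carrier_mat n n"
    and dom: "\<And>r. r < n \<Longrightarrow> (\<Sum>c\<in>{0..<n} - {r}. \<bar>A $$ (r, c)\<bar>) < \<bar>A $$ (r, r)\<bar>"
  shows "det A \<noteq> 0"
proof
  assume "det A = 0"
  then obtain v where v: "v \<in> carrier_vec n" "v \<noteq> 0\<^sub>v n" "A *\<^sub>v v = 0\<^sub>v n"
    using det_0_iff_vec_prod_zero[OF A] by blast
  have "\<exists>c<n. v $ c \<noteq> 0"
    using v(1,2) by (metis carrier_vecD eq_vecI index_zero_vec)
  then obtain c where c: "c < n" "v $ c \<noteq> 0" by blast
  hence "Max ((\<lambda>c. \<bar>v $ c\<bar>) ` {0..<n}) \<in> (\<lambda>c. \<bar>v $ c\<bar>) ` {0..<n}"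
    by (intro Max_in) auto
  then obtain r where r: "r < n" "Max ((\<lambda>c. \<bar>v $ c\<bar>) ` {0..<n}) = \<bar>v $ r\<bar>"
    by auto
  have max: "\<bar>v $ c\<bar> \<le> \<bar>v $ r\<bar>" if "c < n" for c
    unfolding r(2)[symmetric] by (rule Max_ge) (use that in auto)
  have pos: "0 < \<bar>v $ r\<bar>" using max[OF c(1)] c(2) by linarith
  have "0 = (A *\<^sub>v v) $ r" using v r by simp
  also have "\<dots> = (\<Sum>c\<in>{0..<n}. A $$ (r, c) * v $ c)"
    using A v(1) r(1) by (simp add: scalar_prod_def)
  also have "\<dots> = A $$ (r, r) * v $ r + (\<Sum>c\<in>{0..<n} - {r}. A $$ (r, c) * v $ c)"
    using r(1) by (intro sum.remove) auto
  finally have "\<bar>A $$ (r, r)\<bar> * \<bar>v $ r\<bar> = \<bar>\<Sum>c\<in>{0..<n} - {r}. A $$ (r, c) * v $ c\<bar>"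
    by (simp flip: abs_mult)
  also have "\<dots> \<le> (\<Sum>c\<in>{0..<n} - {r}. \<bar>A $$ (r, c)\<bar> * \<bar>v $ r\<bar>)"
    by (rule order_trans[OF sum_abs], rule sum_mono) (auto simp: abs_mult intro!: mult_left_mono max)
  also have "\<dots> = (\<Sum>c\<in>{0..<n} - {r}. \<bar>A $$ (r, c)\<bar>) * \<bar>v $ r\<bar>"
    by (simp add: sum_distrib_right)
  also have "\<dots> < \<bar>A $$ (r, r)\<bar> * \<bar>v $ r\<bar>"
    using dom[OF r(1)] pos by (rule mult_strict_right_mono)
  finally show False by simp
qed

lemma mat_inverse_nonzero_det:
  fixes A :: "'a :: field mat"
  assumes A: "A \<in> carrier_mat n n" and "det A \<noteq> 0"
  shows "A * the (mat_inverse A) = 1\<^sub>m n" "the (mat_inverse A) * A = 1\<^sub>m n"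
    "the (mat_inverse A) \<in> carrier_mat n n"
proof -
  obtain B where "mat_inverse A = Some B"
    using mat_inverse(1)[OF A, where b = "()"] det_non_zero_imp_unit[OF A \<open>det A \<noteq> 0\<close>, where b = "()"]
    by (cases "mat_inverse A") auto
  with mat_inverse(2)[OF A this]
  show "A * the (mat_inverse A) = 1\<^sub>m n" "the (mat_inverse A) * A = 1\<^sub>m n"
    "the (mat_inverse A) \<in> carrier_mat n n" by auto
qed

lemma N_entry_eq_Theta_entry:
  "N_entry M i b k l t r c = (if r = c then 1 else 0) - t * Theta_entry M i b k l r c"
  by (auto simp: N_entry_def Theta_entry_def algebra_simps)

lemma sum_N_entry:
  assumes "2 \<le> r" "r \<le> M - 1" and i: "i (r - 1) < i r" "i r < i (r + 1)"
  shows "(\<Sum>c\<in>{1..M + 1}. N_entry M i b k l t r c) = 1"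
proof -
  have "N_entry M i b k l t r c =
      (if c = r then 1 + t * l r * (1 + k_tilde M i k r) else 0) +
      (if c = r + 1 then - t * l r * q_up i b r else 0) +
      (if c = r - 1 then - t * l r * q_down i b r else 0) +
      (if c = M + 1 then - t * l r * k_tilde M i k r else 0)" for c
    using assms(1,2) by (auto simp: N_entry_def)
  moreover have mem: "r \<in> {1..M + 1}" "r + 1 \<in> {1..M + 1}" "r - 1 \<in> {1..M + 1}" "M + 1 \<in> {1..M + 1}"
    using assms(1,2) by auto
  ultimately have "(\<Sum>c\<in>{1..M + 1}. N_entry M i b k l t r c)
      = 1 + t * l r * (1 - (q_up i b r + q_down i b r))"
    by (simp only: sum.distrib sum.delta finite_atLeastAtMost mem if_True) (simp add: algebra_simps)
  moreover have "q_up i b r + q_down i b r = 1"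
    using i by (simp add: q_up_def q_down_def divide_simps) (simp add: algebra_simps)
  ultimately show ?thesis by simp
qed

lemma sum_Suc_shift: "(\<Sum>c\<in>{0..<n}. f (c + 1)) = (\<Sum>c\<in>{1..n}. f c)"
  for f :: "nat \<Rightarrow> 'a :: comm_monoid_add"
  using sum.shift_bounds_Suc_ivl[of f 0 n] by (simp add: atLeastLessThanSuc_atLeastAtMost)

lemma det_N_mat_nonzero:
  assumes "t > 0" and i: "strict_mono_on {1..M} i"
    and b: "\<forall>j\<in>{2..M - 1}. - (1 / (i (j + 1) - i j)) < b j \<and> b j < 1 / (i j - i (j - 1))"
    and k: "\<forall>j\<in>{2..M - 1}. k j \<ge> 0"
    and l: "\<forall>j\<in>{2..M - 1}. l j \<ge> 0"
  shows "det (N_mat M i b k l t) \<noteq> 0"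
proof (rule det_nonzero_diagonally_dominant)
  show "N_mat M i b k l t \<in> carrier_mat (M + 1) (M + 1)" by (simp add: N_mat_def)
  fix r0 assume r0: "r0 < M + 1"
  define r where "r = r0 + 1"
  let ?N = "N_entry M i b k l t r"
  have eq: "(\<Sum>c\<in>{0..<M + 1} - {r0}. \<bar>N_mat M i b k l t $$ (r0, c)\<bar>)
      = (\<Sum>c\<in>{1..M + 1} - {r}. \<bar>?N c\<bar>)"
    by (rule sum.reindex_bij_witness[of _ "\<lambda>c. c - 1" Suc])
      (use r0 in \<open>auto simp: N_mat_def r_def\<close>)
  have "(\<Sum>c\<in>{1..M + 1} - {r}. \<bar>?N c\<bar>) < \<bar>?N r\<bar>"
  proof (cases "2 \<le> r \<and> r \<le> M - 1")
    case False
    hence "?N c = (if c = r then 1 else 0)" for c by (auto simp: N_entry_def)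
    thus ?thesis by simp
  next
    case True
    have mono: "i (r - 1) < i r" "i r < i (r + 1)"
      using True by (auto intro!: strict_mono_onD[OF i])
    have kt: "0 \<le> k_tilde M i k r"
      using True k mono by (simp add: k_tilde_def)
    have "0 \<le> q_up i b r"
    proof -
      have "- (1 / (i (r + 1) - i r)) < b r" using True b by auto
      hence "0 \<le> 1 + (i (r + 1) - i r) * b r" using mono by (simp add: field_simps)
      thus ?thesis using mono by (simp add: q_up_def)
    qed
    moreover have "0 \<le> q_down i b r"
    proof -
      have "b r < 1 / (i r - i (r - 1))" using True b by auto
      hence "0 \<le> 1 - (i r - i (r - 1)) * b r" using mono by (simp add: field_simps)
      thus ?thesis using mono by (simp add: q_down_def)
    qed
    moreover have tl: "0 \<le> t * l r" using True l \<open>t > 0\<close> by simp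
    ultimately have off: "?N c \<le> 0" if "c \<noteq> r" for c
      using that kt by (auto simp: N_entry_def)
    have "1 = ?N r + (\<Sum>c\<in>{1..M + 1} - {r}. ?N c)"
      by (subst sum.remove[symmetric])
        (use True sum_N_entry[OF conjunct1[OF True] conjunct2[OF True] mono, of b k l t] in auto)
    moreover have "(\<Sum>c\<in>{1..M + 1} - {r}. \<bar>?N c\<bar>) = - (\<Sum>c\<in>{1..M + 1} - {r}. ?N c)"
      unfolding sum_negf[symmetric] by (rule sum.cong) (use off in auto)
    ultimately show ?thesis by simp
  qed
  thus "(\<Sum>c\<in>{0..<M + 1} - {r0}. \<bar>N_mat M i b k l t $$ (r0, c)\<bar>) < \<bar>N_mat M i b k l t $$ (r0, r0)\<bar>"
    unfolding eq using r0 by (simp add: N_mat_def r_def)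
qed

lemma gamma_mean_eq_mat_inverse_power:
  assumes tf: "standard_transition_function {1..M + 1} (Theta_entry M i b k l) P"
    and t: "t > 0" and det: "det (N_mat M i b k l t) \<noteq> 0"
    and x: "x \<in> {1..M + 1}" and y: "y \<in> {1..M + 1}"
  shows "(the (mat_inverse (N_mat M i b k l t)) ^\<^sub>m p) $$ (x - 1, y - 1)
    = (LINT s|gamma_law p (1 / t). P (max 0 s) x y)"
proof -
  interpret standard_transition_function "{1..M + 1}" "Theta_entry M i b k l" P by fact
  let ?n = "M + 1" and ?N = "N_mat M i b k l t"
  define G where "G = mat ?n ?n (\<lambda>(r, c). resolvent (1 / t) (r + 1) (c + 1))"
  have N: "?N \<in> carrier_mat ?n ?n" by (simp add: N_mat_def)
  have G: "G \<in> carrier_mat ?n ?n" by (simp add: G_def)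
  note inv = mat_inverse_nonzero_det[OF N det]
  have "G * ?N = 1\<^sub>m ?n"
  proof (rule eq_matI)
    fix r c assume "r < dim_row (1\<^sub>m ?n)" "c < dim_col (1\<^sub>m ?n)"
    hence rc: "r < ?n" "c < ?n" by auto
    let ?\<Theta> = "\<lambda>d. Theta_entry M i b k l d (c + 1)"
    have "(G * ?N) $$ (r, c)
        = (\<Sum>d\<in>{0..<?n}. resolvent (1 / t) (r + 1) (d + 1) * N_entry M i b k l t (d + 1) (c + 1))"
      using rc by (simp add: G_def N_mat_def scalar_prod_def)
    also have "\<dots> = (\<Sum>d\<in>{1..?n}. resolvent (1 / t) (r + 1) d * N_entry M i b k l t d (c + 1))"
      by (rule sum_Suc_shift)
    also have "\<dots> = (\<Sum>d\<in>{1..?n}. if d = c + 1 then resolvent (1 / t) (r + 1) d else 0)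
        - t * (\<Sum>d\<in>{1..?n}. resolvent (1 / t) (r + 1) d * ?\<Theta> d)"
      unfolding sum_distrib_left sum_subtractf[symmetric]
      by (rule sum.cong) (auto simp: N_entry_eq_Theta_entry algebra_simps)
    also have "\<dots> = resolvent (1 / t) (r + 1) (c + 1)
        - (\<Sum>d\<in>{1..?n}. resolvent (1 / t) (r + 1) d * ?\<Theta> d) / (1 / t)"
      using rc by simp
    also have "\<dots> = (if r + 1 = c + 1 then 1 else 0)"
      by (rule resolvent_equation) (use rc t in auto)
    finally show "(G * ?N) $$ (r, c) = 1\<^sub>m ?n $$ (r, c)" using rc by simp
  qed (use G N in auto)
  hence "the (mat_inverse ?N) = G * ?N * the (mat_inverse ?N)"
    using inv(3) by simp
  also have "\<dots> = G"
    using G N inv by (simp add: assoc_mult_mat[OF G N inv(3)])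
  finally have "the (mat_inverse ?N) = G" .
  moreover have "(G ^\<^sub>m p) $$ (x - 1, y - 1) = gamma_mean (1 / t) p x y"
    using y
  proof (induction p arbitrary: y)
    case 0
    show ?case using gamma_mean_0[OF x 0] x 0 by (auto simp: G_def)
  next
    case (Suc p)
    have "(G ^\<^sub>m Suc p) $$ (x - 1, y - 1)
        = (\<Sum>d\<in>{0..<?n}. (G ^\<^sub>m p) $$ (x - 1, (d + 1) - 1) * resolvent (1 / t) (d + 1) y)"
      using x Suc.prems G pow_carrier_mat[OF G, of p] by (auto simp: scalar_prod_def G_def)
    also have "\<dots> = (\<Sum>d\<in>{1..?n}. (G ^\<^sub>m p) $$ (x - 1, d - 1) * resolvent (1 / t) d y)"
      by (rule sum_Suc_shift)
    also have "\<dots> = gamma_mean (1 / t) (Suc p) x y"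
      by (subst gamma_mean_Suc[OF _ x Suc.prems], use t in simp, rule sum.cong) (simp_all only: Suc.IH)
    finally show ?case .
  qed
  ultimately show ?thesis by (simp add: gamma_mean_def)
qed

theorem lemma7p1:
  fixes M :: nat and i b k l :: "nat \<Rightarrow> real" and t :: real
  assumes "M \<ge> 3" and "t > 0"
    and "strict_mono_on {1..M} i"
    and "\<forall>j\<in>{2..M - 1}. - (1 / (i (j + 1) - i j)) < b j \<and> b j < 1 / (i j - i (j - 1))"
    and "\<forall>j\<in>{2..M - 1}. k j \<ge> 0"
    and "\<forall>j\<in>{2..M - 1}. l j \<ge> 0"
  shows "invertible_mat (N_mat M i b k l t) \<and>
    (\<forall>p\<ge>1. \<forall>(\<Omega> :: 'w measure) Z T.
       ctmc \<Omega> {1..M + 1} (Theta_entry M i b k l) Z \<longrightarrow>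
       T \<in> borel_measurable \<Omega> \<longrightarrow>
       (\<forall>\<omega>\<in>space \<Omega>. T \<omega> \<ge> 0) \<longrightarrow>
       distr \<Omega> borel T = gamma_law p (1 / t) \<longrightarrow>
       indep_of_process \<Omega> {1..M + 1} T Z \<longrightarrow>
       (\<forall>j\<in>{1..M + 1}. \<forall>m\<in>{1..M + 1}.
          \<P>(\<omega> in \<Omega>. Z 0 \<omega> = j) > 0 \<longrightarrow>
          (the (mat_inverse (N_mat M i b k l t)) ^\<^sub>m p) $$ (j - 1, m - 1)
            = \<P>(\<omega> in \<Omega>. Z (T \<omega>) \<omega> = m \<bar> Z 0 \<omega> = j)))"
proof (intro conjI allI impI ballI)
  let ?N = "N_mat M i b k l t" and ?S = "{1..M + 1}" and ?\<Theta> = "Theta_entry M i b k l"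
  have N: "?N \<in> carrier_mat (M + 1) (M + 1)" by (simp add: N_mat_def)
  have det: "det ?N \<noteq> 0" using assms(2-6) by (rule det_N_mat_nonzero)
  from mat_inverse_nonzero_det[OF N det] show "invertible_mat ?N"
    using N unfolding invertible_mat_def inverts_mat_def by auto

  fix p and \<Omega> :: "'w measure" and Z T j m
  assume Z: "ctmc \<Omega> ?S ?\<Theta> Z" and T: "T \<in> borel_measurable \<Omega>"
    and T_nonneg: "\<forall>\<omega>\<in>space \<Omega>. T \<omega> \<ge> 0"
    and law: "distr \<Omega> borel T = gamma_law p (1 / t)"
    and indep: "indep_of_process \<Omega> ?S T Z"
    and j: "j \<in> ?S" and m: "m \<in> ?S" and pos: "\<P>(\<omega> in \<Omega>. Z 0 \<omega> = j) > 0"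
  obtain P where P: "transition_function_of ?S ?\<Theta> P"
    and markov: "\<And>n (\<tau> :: nat \<Rightarrow> real) x. \<lbrakk>0 \<le> \<tau> 0; strict_mono_on {..Suc n} \<tau>; \<forall>m\<le>Suc n. x m \<in> ?S;
           \<P>(\<omega> in \<Omega>. \<forall>m\<le>n. Z (\<tau> m) \<omega> = x m) > 0\<rbrakk> \<Longrightarrow>
           \<P>(\<omega> in \<Omega>. Z (\<tau> (Suc n)) \<omega> = x (Suc n) \<bar> \<forall>m\<le>n. Z (\<tau> m) \<omega> = x m)
             = P (\<tau> (Suc n) - \<tau> n) (x n) (x (Suc n))"
    using Z unfolding ctmc_def by blast
  have tf: "standard_transition_function ?S ?\<Theta> P"
    by standard (simp, rule P)
  interpret standard_transition_function ?S ?\<Theta> P by (rule tf)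
  have cond: "\<P>(\<omega> in \<Omega>. Z s \<omega> = m \<bar> Z 0 \<omega> = j) = P s j m" if "0 < s" for s
    using markov[of "\<lambda>n. if n = 0 then 0 else s" 0 "\<lambda>n. if n = 0 then j else m"] that j m pos
    by (auto simp: strict_mono_on_def)
  have "\<P>(\<omega> in \<Omega>. Z (T \<omega>) \<omega> = m \<bar> Z 0 \<omega> = j) = (LINT \<omega>|\<Omega>. P (max 0 (T \<omega>)) j m)"
    using Z T_nonneg unfolding ctmc_def
    by (intro cond_prob_random_time T indep j m pos cond) blast+
  also have "\<dots> = (LINT s|distr \<Omega> borel T. P (max 0 s) j m)"
    by (rule integral_distr[OF T borel_measurable_P[OF j m], symmetric])
  also have "\<dots> = (the (mat_inverse ?N) ^\<^sub>m p) $$ (j - 1, m - 1)"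
    unfolding law by (rule gamma_mean_eq_mat_inverse_power[OF tf assms(2) det j m, symmetric])
  finally show "(the (mat_inverse ?N) ^\<^sub>m p) $$ (j - 1, m - 1)
      = \<P>(\<omega> in \<Omega>. Z (T \<omega>) \<omega> = m \<bar> Z 0 \<omega> = j)" by simp
qed

end
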